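(* Let $f$ be a 2-cell with four edges such that, in a given chart of $f$, the edges are parametrised by $I_i(t)=(h_i(t),g_i(t))$, $t\in[0,1]$, $i\in\{1,2,3,4\}$, where the $h_i,g_i$ are $C^2$ and $$\begin{aligned}(h_1(0),g_1(0))&=(0,0),&(h_1(1),g_1(1))&=(1,0),\\(h_2(0),g_2(0))&=(1,0),&(h_2(1),g_2(1))&=(a,b),\\(h_3(0),g_3(0))&=(0,1),&(h_3(1),g_3(1))&=(a,b),\\(h_4(0),g_4(0))&=(0,0),&(h_4(1),g_4(1))&=(0,1),\end{aligned}$$ with $a,b\neq0$. Let $I_f:[0,1]^2\to\overline f$ be $$I_f(t,p):=\begin{pmatrix}\big(p\frac{h_3(t)}a+(1-p)h_1(t)\big)h_2(p)+\big(1-(p\frac{h_3(t)}a+(1-p)h_1(t))\big)h_4(p)\\[1mm]\big(t\frac{g_2(p)}b+(1-t)g_4(p)\big)g_3(t)+\big(1-(t\frac{g_2(p)}b+(1-t)g_4(p))\big)g_1(t)\end{pmatrix}.$$ If $I_f$ is bijective (from $[0,1]^2$ onto $\overline f$) and $\det(\mathrm D I_f)\ne0$ everywhere, then $I_f$ provides affine compatible local coordinates on $f$: $I_f$ is a $C^2$-diffeomorphism onto $\overline f$ and, with $J_f:=I_f^{-1}$, for each $i\in\{1,2,3,4\}$ the map $J_f\circ I_i:[0,1]\to\mathbb R^2$ is affine.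
   Context: The cell is identified with its image in the chart; $\overline f\subset\mathbb R^2$ is the closed region bounded by the four edges. A $C^2$-diffeomorphism $I_f:U_f\subset\mathbb R^2\to\overline f$ is said to provide affine compatible local coordinates if, for every edge $E$ of $f$ with its chosen parametrisation $I_E:[0,1]\to\overline E$, the composition $I_f^{-1}\circ I_E$ is affine. $\mathrm D I_f$ is the Jacobian matrix of $I_f$. *)

theory Defs
  imports "HOL-Analysis.Analysis"
begin

(* Derivatives are taken within S: the usual notion on an open set,
   one-sided derivatives at the end points on a compact interval. *)
definition C2_on :: "'a::real_normed_vector set \<Rightarrow> ('a \<Rightarrow> 'b::real_normed_vector) \<Rightarrow> bool" where
  "C2_on S \<phi> \<longleftrightarrow>
     (\<exists>(\<phi>' :: 'a \<Rightarrow> 'a \<Rightarrow>\<^sub>L 'b) (\<phi>'' :: 'a \<Rightarrow> 'a \<Rightarrow>\<^sub>L ('a \<Rightarrow>\<^sub>L 'b)).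
        (\<forall>x\<in>S. (\<phi> has_derivative blinfun_apply (\<phi>' x)) (at x within S)) \<and>
        (\<forall>x\<in>S. (\<phi>' has_derivative blinfun_apply (\<phi>'' x)) (at x within S)) \<and>
        continuous_on S \<phi>'')"

(* For maps on non-open subsets of a vector space, such as a closed cell with corners,
   C^2 means extendable to a C^2 map on an open neighbourhood. *)
definition C2_extendable_on :: "'a::real_normed_vector set \<Rightarrow> ('a \<Rightarrow> 'b::real_normed_vector) \<Rightarrow> bool" where
  "C2_extendable_on S \<phi> \<longleftrightarrow>
     (\<exists>U \<psi>. open U \<and> S \<subseteq> U \<and> C2_on U \<psi> \<and> (\<forall>x\<in>S. \<psi> x = \<phi> x))"

definition C2_diffeomorphism ::
  "'a::real_normed_vector set \<Rightarrow> 'b::real_normed_vector set \<Rightarrow> ('a \<Rightarrow> 'b) \<Rightarrow> bool" where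
  "C2_diffeomorphism S T \<phi> \<longleftrightarrow>
     bij_betw \<phi> S T \<and> C2_extendable_on S \<phi> \<and> C2_extendable_on T (inv_into S \<phi>)"

definition affine_curve :: "(real \<Rightarrow> 'a::real_vector) \<Rightarrow> bool" where
  "affine_curve \<gamma> \<longleftrightarrow> (\<exists>c v. \<forall>t\<in>{0..1}. \<gamma> t = c + t *\<^sub>R v)"

(* U is the coordinate domain, f the (open) cell, E the set of parametrised edges of f. *)
definition affine_compatible_coordinates ::
  "(real^2) set \<Rightarrow> (real^2) set \<Rightarrow> (real \<Rightarrow> real^2) set \<Rightarrow> (real^2 \<Rightarrow> real^2) \<Rightarrow> bool" where
  "affine_compatible_coordinates U f E \<phi> \<longleftrightarrow>
     C2_diffeomorphism U (closure f) \<phi> \<and>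
     (\<forall>\<gamma>\<in>E. affine_curve (inv_into U \<phi> \<circ> \<gamma>))"

(* Edges 1 and 2 lead from the initial vertex to the opposite one, and so do edges 4 and 3;
   the boundary loop therefore runs through 1, 2, then 3 and 4 backwards.
   By the Jordan curve theorem, closure f is f together with the four edges. *)
definition four_edge_cell :: "(real^2) set \<Rightarrow> (nat \<Rightarrow> real \<Rightarrow> real^2) \<Rightarrow> bool" where
  "four_edge_cell f I \<longleftrightarrow>
     simple_path ((I 1 +++ I 2) +++ reversepath (I 4 +++ I 3)) \<and>
     f = inside (\<Union>i\<in>{1,2,3,4}. path_image (I i))"

definition edge :: "(nat \<Rightarrow> real \<Rightarrow> real) \<Rightarrow> (nat \<Rightarrow> real \<Rightarrow> real) \<Rightarrow> nat \<Rightarrow> real \<Rightarrow> real^2" where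
  "edge h g i t = vector [h i t, g i t]"

definition cell_map ::
  "(nat \<Rightarrow> real \<Rightarrow> real) \<Rightarrow> (nat \<Rightarrow> real \<Rightarrow> real) \<Rightarrow> real \<Rightarrow> real \<Rightarrow> real^2 \<Rightarrow> real^2" where
  "cell_map h g a b x = (let t = x $ 1; p = x $ 2 in
     vector
       [(p * (h 3 t / a) + (1 - p) * h 1 t) * h 2 p
          + (1 - (p * (h 3 t / a) + (1 - p) * h 1 t)) * h 4 p,
        (t * (g 2 p / b) + (1 - t) * g 4 p) * g 3 t
          + (1 - (t * (g 2 p / b) + (1 - t) * g 4 p)) * g 1 t])"

end

theory Submission
  imports Defs
begin

text \<open>
  The one-variable \<open>C\<^sup>2\<close> functions extend from \<open>[0,1]\<close> to the whole line, so the cell map extends to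
  a \<open>C\<^sup>2\<close> map of the plane whose differential is invertible on the compact square. A map that is
  injective on a compact set and a local diffeomorphism near each of its points is a diffeomorphism
  on a whole neighbourhood of that set, which gives the \<open>C\<^sup>2\<close> extension of the inverse. Restricted
  to the sides of the square, the cell map reproduces the four edge parametrisations, so in the
  coordinates each edge is a side of the square run through at constant speed.
\<close>

section \<open>Calculus of continuously differentiable maps\<close>

text \<open>Derivatives are maps into the normed space of bounded operators, so the notion applies
  to a derivative in turn: \<open>C2_on\<close> then says that the derivative is
  \<open>C1_on\<close>, which is what lets regularity be raised by one order at a time.\<close>

definition C1_on :: "'a::real_normed_vector set \<Rightarrow> ('a \<Rightarrow> 'b::real_normed_vector) \<Rightarrow> bool" where
  "C1_on S f \<longleftrightarrow>
     (\<exists>f' :: 'a \<Rightarrow> 'a \<Rightarrow>\<^sub>L 'b.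
        (\<forall>x\<in>S. (f has_derivative blinfun_apply (f' x)) (at x within S)) \<and> continuous_on S f')"

lemma C1_onI:
  assumes "\<And>x. x \<in> S \<Longrightarrow> (f has_derivative blinfun_apply (f' x)) (at x within S)"
    and "continuous_on S f'"
  shows "C1_on S f"
  using assms unfolding C1_on_def by blast

lemma C1_onE:
  assumes "C1_on S f"
  obtains f' where "\<And>x. x \<in> S \<Longrightarrow> (f has_derivative blinfun_apply (f' x)) (at x within S)"
    and "continuous_on S f'"
  using assms unfolding C1_on_def by blast

lemma C2_on_iff_C1_on:
  "C2_on S f \<longleftrightarrow>
     (\<exists>f'. (\<forall>x\<in>S. (f has_derivative blinfun_apply (f' x)) (at x within S)) \<and> C1_on S f')"
  unfolding C2_on_def C1_on_def by blast

lemma C2_onI: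
  assumes "\<And>x. x \<in> S \<Longrightarrow> (f has_derivative blinfun_apply (f' x)) (at x within S)"
    and "C1_on S f'"
  shows "C2_on S f"
  using assms unfolding C2_on_iff_C1_on by blast

lemma C2_onE:
  assumes "C2_on S f"
  obtains f' where "\<And>x. x \<in> S \<Longrightarrow> (f has_derivative blinfun_apply (f' x)) (at x within S)"
    and "C1_on S f'"
  using assms unfolding C2_on_iff_C1_on by blast

lemma C1_on_imp_continuous_on:
  assumes "C1_on S f"
  shows "continuous_on S f"
  using assms by (elim C1_onE) (rule has_derivative_continuous_on)

lemma C2_on_imp_C1_on:
  assumes "C2_on S f"
  shows "C1_on S f"
  using assms by (elim C2_onE) (rule C1_onI, auto intro: C1_on_imp_continuous_on)

lemma C1_on_const: "C1_on S (\<lambda>_. c)"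
  by (rule C1_onI[where f' = "\<lambda>_. 0"]) (auto simp: zero_blinfun.rep_eq)

lemma C2_on_const: "C2_on S (\<lambda>_. c)"
  by (rule C2_onI[where f' = "\<lambda>_. 0"]) (auto simp: zero_blinfun.rep_eq intro: C1_on_const)

lemma C1_on_add:
  assumes "C1_on S f" "C1_on S g"
  shows "C1_on S (\<lambda>x. f x + g x)"
proof -
  obtain f' g'
    where "\<And>x. x \<in> S \<Longrightarrow> (f has_derivative blinfun_apply (f' x)) (at x within S)"
      and "\<And>x. x \<in> S \<Longrightarrow> (g has_derivative blinfun_apply (g' x)) (at x within S)"
      and "continuous_on S f'" "continuous_on S g'"
    using assms unfolding C1_on_def by blast
  then show ?thesis
    by (intro C1_onI[where f' = "\<lambda>x. f' x + g' x"])
      (auto simp: plus_blinfun.rep_eq intro!: derivative_eq_intros continuous_intros)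
qed

lemma C2_on_add:
  assumes "C2_on S f" "C2_on S g"
  shows "C2_on S (\<lambda>x. f x + g x)"
proof -
  obtain f' g'
    where "\<And>x. x \<in> S \<Longrightarrow> (f has_derivative blinfun_apply (f' x)) (at x within S)"
      and "\<And>x. x \<in> S \<Longrightarrow> (g has_derivative blinfun_apply (g' x)) (at x within S)"
      and "C1_on S f'" "C1_on S g'"
    using assms unfolding C2_on_iff_C1_on by blast
  then show ?thesis
    by (intro C2_onI[where f' = "\<lambda>x. f' x + g' x"])
      (auto simp: plus_blinfun.rep_eq intro!: derivative_eq_intros C1_on_add)
qed

lemma C1_on_bounded_linear:
  assumes "bounded_linear L"
  shows "C1_on S L"
  by (rule C1_onI[where f' = "\<lambda>_. Blinfun L"])
    (auto simp: bounded_linear_Blinfun_apply[OF assms] intro: bounded_linear_imp_has_derivative assms)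

lemma C2_on_bounded_linear:
  assumes "bounded_linear L"
  shows "C2_on S L"
  by (rule C2_onI[where f' = "\<lambda>_. Blinfun L"])
    (auto simp: bounded_linear_Blinfun_apply[OF assms]
      intro: bounded_linear_imp_has_derivative assms C1_on_const)

lemma C1_on_compose:
  assumes f: "C1_on T f" and g: "C1_on S g" and "g ` S \<subseteq> T"
  shows "C1_on S (\<lambda>x. f (g x))"
proof -
  obtain f' where f': "\<And>x. x \<in> T \<Longrightarrow> (f has_derivative blinfun_apply (f' x)) (at x within T)"
      and cf': "continuous_on T f'"
    using f unfolding C1_on_def by blast
  obtain g' where g': "\<And>x. x \<in> S \<Longrightarrow> (g has_derivative blinfun_apply (g' x)) (at x within S)"
      and cg': "continuous_on S g'"
    using g unfolding C1_on_def by blast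
  have "((\<lambda>x. f (g x)) has_derivative blinfun_apply (f' (g x) o\<^sub>L g' x)) (at x within S)"
    if "x \<in> S" for x
  proof -
    have "(f has_derivative blinfun_apply (f' (g x))) (at (g x) within g ` S)"
      using f'[of "g x"] that \<open>g ` S \<subseteq> T\<close> has_derivative_subset by blast
    from diff_chain_within[OF g'[OF that] this] show ?thesis
      by (simp add: o_def blinfun_compose.rep_eq)
  qed
  moreover have "continuous_on S (\<lambda>x. f' (g x) o\<^sub>L g' x)"
    using continuous_on_compose2[OF cf' C1_on_imp_continuous_on[OF g] \<open>g ` S \<subseteq> T\<close>] cg'
    by (intro continuous_intros)
  ultimately show ?thesis
    by (rule C1_onI)
qed

text \<open>One product rule serves multiplication, scaling and operator composition. The partial
  products \<open>prod_right (f x)\<close> and \<open>prod_left (g x)\<close> are operators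
  depending linearly and boundedly on \<open>f x\<close> and \<open>g x\<close>, so the derivative
  inherits continuity.\<close>

lemma (in bounded_bilinear) C1_on_bilinear:
  assumes "C1_on S f" "C1_on S g"
  shows "C1_on S (\<lambda>x. prod (f x) (g x))"
proof -
  obtain f' g'
    where f': "\<And>x. x \<in> S \<Longrightarrow> (f has_derivative blinfun_apply (f' x)) (at x within S)"
      and g': "\<And>x. x \<in> S \<Longrightarrow> (g has_derivative blinfun_apply (g' x)) (at x within S)"
      and c: "continuous_on S f'" "continuous_on S g'"
    using assms unfolding C1_on_def by blast
  note cfg = C1_on_imp_continuous_on[OF assms(1)] C1_on_imp_continuous_on[OF assms(2)]
  show ?thesis
  proof (rule C1_onI[where f' = "\<lambda>x. (prod_right (f x) o\<^sub>L g' x) + (prod_left (g x) o\<^sub>L f' x)"])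
    show "((\<lambda>x. prod (f x) (g x)) has_derivative
        blinfun_apply ((prod_right (f x) o\<^sub>L g' x) + (prod_left (g x) o\<^sub>L f' x))) (at x within S)"
      if "x \<in> S" for x
      using FDERIV[OF f'[OF that] g'[OF that]]
      by (rule has_derivative_eq_rhs) (auto simp: plus_blinfun.rep_eq)
    show "continuous_on S (\<lambda>x. (prod_right (f x) o\<^sub>L g' x) + (prod_left (g x) o\<^sub>L f' x))"
      using c cfg
      by (intro continuous_intros bounded_linear.continuous_on[OF bounded_linear_prod_left]
          bounded_linear.continuous_on[OF bounded_linear_prod_right])
  qed
qed

lemmas C1_on_blinfun_compose = bounded_bilinear.C1_on_bilinear[OF bounded_bilinear_blinfun_compose]

text \<open>The derivative from the product rule is a sum of operator compositions, again a bounded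
  bilinear product, so the first-order rule applies to it.\<close>

lemma (in bounded_bilinear) C2_on_bilinear:
  assumes "C2_on S f" "C2_on S g"
  shows "C2_on S (\<lambda>x. prod (f x) (g x))"
proof -
  obtain f' g'
    where f': "\<And>x. x \<in> S \<Longrightarrow> (f has_derivative blinfun_apply (f' x)) (at x within S)"
      and g': "\<And>x. x \<in> S \<Longrightarrow> (g has_derivative blinfun_apply (g' x)) (at x within S)"
      and c: "C1_on S f'" "C1_on S g'"
    using assms unfolding C2_on_iff_C1_on by blast
  have c1: "C1_on S (\<lambda>x. prod_right (f x))" "C1_on S (\<lambda>x. prod_left (g x))"
    using C1_on_compose[OF C1_on_bounded_linear[OF bounded_linear_prod_right]
        C2_on_imp_C1_on[OF assms(1)] subset_UNIV]
      C1_on_compose[OF C1_on_bounded_linear[OF bounded_linear_prod_left]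
        C2_on_imp_C1_on[OF assms(2)] subset_UNIV] .
  show ?thesis
  proof (rule C2_onI[where f' = "\<lambda>x. (prod_right (f x) o\<^sub>L g' x) + (prod_left (g x) o\<^sub>L f' x)"])
    show "((\<lambda>x. prod (f x) (g x)) has_derivative
        blinfun_apply ((prod_right (f x) o\<^sub>L g' x) + (prod_left (g x) o\<^sub>L f' x))) (at x within S)"
      if "x \<in> S" for x
      using FDERIV[OF f'[OF that] g'[OF that]]
      by (rule has_derivative_eq_rhs) (auto simp: plus_blinfun.rep_eq)
    show "C1_on S (\<lambda>x. (prod_right (f x) o\<^sub>L g' x) + (prod_left (g x) o\<^sub>L f' x))"
      using c c1 by (intro C1_on_add C1_on_blinfun_compose)
  qed
qed

lemmas C2_on_mult = bounded_bilinear.C2_on_bilinear[OF bounded_bilinear_mult]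
lemmas C2_on_scaleR = bounded_bilinear.C2_on_bilinear[OF bounded_bilinear_scaleR]

lemma C2_on_diff:
  assumes "C2_on S f" "C2_on S g"
  shows "C2_on S (\<lambda>x. f x - g x)"
  using C2_on_add[OF assms(1) C2_on_scaleR[OF C2_on_const[of S "-1"] assms(2)]] by simp

lemma C2_on_divide_const:
  fixes f :: "'a::real_normed_vector \<Rightarrow> 'b::real_normed_field"
  assumes "C2_on S f"
  shows "C2_on S (\<lambda>x. f x / c)"
  using C2_on_mult[OF assms C2_on_const[of S "inverse c"]] by (simp add: divide_inverse)

text \<open>The chain rule gives a composition of two operator-valued maps that are both
  \<open>C1_on\<close>, and the first-order product rule handles that composition.\<close>

lemma C2_on_compose:
  assumes f: "C2_on T f" and g: "C2_on S g" and "g ` S \<subseteq> T"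
  shows "C2_on S (\<lambda>x. f (g x))"
proof -
  obtain f' where f': "\<And>x. x \<in> T \<Longrightarrow> (f has_derivative blinfun_apply (f' x)) (at x within T)"
      and cf': "C1_on T f'"
    using f unfolding C2_on_iff_C1_on by blast
  obtain g' where g': "\<And>x. x \<in> S \<Longrightarrow> (g has_derivative blinfun_apply (g' x)) (at x within S)"
      and cg': "C1_on S g'"
    using g unfolding C2_on_iff_C1_on by blast
  have "((\<lambda>x. f (g x)) has_derivative blinfun_apply (f' (g x) o\<^sub>L g' x)) (at x within S)"
    if "x \<in> S" for x
  proof -
    have "(f has_derivative blinfun_apply (f' (g x))) (at (g x) within g ` S)"
      using f'[of "g x"] that \<open>g ` S \<subseteq> T\<close> has_derivative_subset by blast
    from diff_chain_within[OF g'[OF that] this] show ?thesis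
      by (simp add: o_def blinfun_compose.rep_eq)
  qed
  moreover have "C1_on S (\<lambda>x. f' (g x) o\<^sub>L g' x)"
    using C1_on_compose[OF cf' C2_on_imp_C1_on[OF g] \<open>g ` S \<subseteq> T\<close>] cg'
    by (rule C1_on_blinfun_compose)
  ultimately show ?thesis
    by (rule C2_onI)
qed

section \<open>Pointwise inverses of operator-valued maps\<close>

text \<open>The resolvent identity: expanding \<open>B2 (A2 - A1) B1\<close> and cancelling leaves
  \<open>B1 - B2\<close>. It bounds a change of the inverse by the change of the operator.\<close>

lemma blinfun_inverse_diff:
  assumes "B2 o\<^sub>L A2 = id_blinfun" and "A1 o\<^sub>L B1 = id_blinfun"
  shows "B2 - B1 = - (B2 o\<^sub>L (A2 - A1) o\<^sub>L B1)"
proof -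
  have "blinfun_apply B2 (blinfun_apply A2 v) = v" "blinfun_apply A1 (blinfun_apply B1 w) = w" for v w
    using assms by (metis blinfun_apply_blinfun_compose blinfun_apply_id_blinfun)+
  then show ?thesis
    by (intro blinfun_eqI) (simp add: blinfun.bilinear_simps)
qed

lemma norm_blinfun_compose3: "norm (P o\<^sub>L Q o\<^sub>L R) \<le> norm P * norm Q * norm R"
  by (rule order_trans[OF norm_blinfun_compose]) (intro mult_right_mono norm_blinfun_compose norm_ge_zero)

text \<open>The resolvent identity bounds \<open>B y - B x\<close> by a product containing the
  unknown factor \<open>norm (B y)\<close>. That factor is first shown to be bounded near
  \<open>x\<close>; then the bound tends to 0 with \<open>A y - A x\<close>.\<close>

lemma continuous_within_blinfun_inverse:
  fixes A :: "'a::t2_space \<Rightarrow> 'b::real_normed_vector \<Rightarrow>\<^sub>L 'c::real_normed_vector"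
  assumes A: "continuous (at x within S) A" and "x \<in> S"
    and inv: "\<And>y. y \<in> S \<Longrightarrow> A y o\<^sub>L B y = id_blinfun" "\<And>y. y \<in> S \<Longrightarrow> B y o\<^sub>L A y = id_blinfun"
  shows "continuous (at x within S) B"
proof -
  define d where "d y = norm (A y - A x)" for y
  have d0: "(d \<longlongrightarrow> 0) (at x within S)"
    using A unfolding d_def continuous_within by (simp add: LIM_zero tendsto_norm_zero)
  have bound: "norm (B y - B x) \<le> norm (B y) * d y * norm (B x)" if "y \<in> S" for y
    unfolding d_def blinfun_inverse_diff[OF inv(2)[OF that] inv(1)[OF \<open>x \<in> S\<close>]] norm_minus_cancel
    by (rule norm_blinfun_compose3)
  have "((\<lambda>y. d y * norm (B x)) \<longlongrightarrow> 0 * norm (B x)) (at x within S)"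
    by (intro tendsto_intros d0)
  \<comment> \<open>With the threshold 1/2, the triangle inequality reads
    \<open>norm (B y) \<le> norm (B x) + norm (B y) / 2\<close>, and absorbing the last term bounds
    \<open>norm (B y)\<close> by \<open>2 * norm (B x)\<close>.\<close>
  then have "\<forall>\<^sub>F y in at x within S. d y * norm (B x) < 1 / 2"
    by (rule order_tendstoD) simp
  moreover have "\<forall>\<^sub>F y in at x within S. y \<in> S"
    by (simp add: eventually_at_filter)
  ultimately have "\<forall>\<^sub>F y in at x within S. norm (B y - B x) \<le> 2 * norm (B x) * d y * norm (B x)"
  proof eventually_elim
    case (elim y)
    have "0 \<le> d y" by (simp add: d_def)
    have "norm (B y) \<le> norm (B x) + norm (B y - B x)"
      by (simp add: norm_triangle_sub)
    also have "norm (B y - B x) \<le> norm (B y) * (d y * norm (B x))"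
      using bound[OF elim(2)] by (simp only: mult.assoc)
    also have "\<dots> \<le> norm (B y) * (1 / 2)"
      using elim(1) by (intro mult_left_mono) auto
    finally have "norm (B y) \<le> 2 * norm (B x)" by simp
    then have "norm (B y) * d y * norm (B x) \<le> 2 * norm (B x) * d y * norm (B x)"
      using \<open>0 \<le> d y\<close> by (intro mult_right_mono) auto
    with bound[OF elim(2)] show ?case
      by (rule order_trans)
  qed
  moreover have "((\<lambda>y. 2 * norm (B x) * d y * norm (B x)) \<longlongrightarrow> 0) (at x within S)"
    by (rule tendsto_eq_intros d0 refl | simp)+
  ultimately have "((\<lambda>y. B y - B x) \<longlongrightarrow> 0) (at x within S)"
    by (rule Lim_null_comparison)
  then show ?thesis
    by (simp add: continuous_within LIM_zero_iff)
qed

text \<open>In the resolvent identity, replacing \<open>B y\<close> by \<open>B x\<close> and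
  \<open>A y - A x\<close> by its linear part gives the asserted derivative; both replacements cost
  only o(\<open>norm (y - x)\<close>), the first because \<open>B\<close> is continuous.\<close>

lemma has_derivative_blinfun_inverse:
  fixes A :: "'a::real_normed_vector \<Rightarrow> 'b::real_normed_vector \<Rightarrow>\<^sub>L 'c::real_normed_vector"
  assumes A: "(A has_derivative A') (at x within S)" and "x \<in> S"
    and inv: "\<And>y. y \<in> S \<Longrightarrow> A y o\<^sub>L B y = id_blinfun" "\<And>y. y \<in> S \<Longrightarrow> B y o\<^sub>L A y = id_blinfun"
  shows "(B has_derivative (\<lambda>h. - (B x o\<^sub>L A' h o\<^sub>L B x))) (at x within S)"
proof -
  define r where "r y = norm (A y - A x - A' (y - x)) / norm (y - x)" for y
  have A'lin: "bounded_linear A'" and r: "(r \<longlongrightarrow> 0) (at x within S)"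
    using A unfolding has_derivative_iff_norm r_def by auto
  obtain M where M: "\<And>h. norm (A' h) \<le> norm h * M"
    using bounded_linear.bounded[OF A'lin] by blast
  have "continuous (at x within S) B"
    using has_derivative_continuous[OF A] \<open>x \<in> S\<close> inv by (rule continuous_within_blinfun_inverse)
  then have B: "((\<lambda>y. norm (B y - B x)) \<longlongrightarrow> 0) (at x within S)"
    by (simp add: continuous_within LIM_zero tendsto_norm_zero)
  \<comment> \<open>The error relative to \<open>norm (y - x)\<close>: the first summand pays for
    replacing \<open>B y\<close> by \<open>B x\<close>, with \<open>r y + M\<close> bounding the
    difference quotient of \<open>A\<close>; the second pays for linearising
    \<open>A\<close>.\<close>
  define H where "H y = norm (B y - B x) * (r y + M) * norm (B x)
      + norm (B x) * r y * norm (B x)" for y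
  have "(H \<longlongrightarrow> 0 * (0 + M) * norm (B x) + norm (B x) * 0 * norm (B x)) (at x within S)"
    unfolding H_def by (intro tendsto_intros B r)
  then have H: "(H \<longlongrightarrow> 0) (at x within S)" by simp
  show ?thesis
  proof (rule has_derivativeI_sandwich[OF zero_less_one _ _ H])
    show "bounded_linear (\<lambda>h. - (B x o\<^sub>L A' h o\<^sub>L B x))"
      by (intro bounded_linear_minus
          bounded_linear_compose[OF bounded_bilinear.bounded_linear_left[OF bounded_bilinear_blinfun_compose]]
          bounded_linear_compose[OF bounded_bilinear.bounded_linear_right[OF bounded_bilinear_blinfun_compose]]
          A'lin)
  next
    fix y assume "y \<in> S" "y \<noteq> x" "dist y x < 1"
    define n where "n = norm (y - x)"
    have "n > 0" using \<open>y \<noteq> x\<close> by (simp add: n_def)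
    define R where "R = A y - A x - A' (y - x)"
    have nR: "norm R = r y * n" using \<open>n > 0\<close> by (simp add: R_def r_def n_def)
    have D: "norm (A y - A x) \<le> (r y + M) * n"
      using norm_triangle_ineq[of R "A' (y - x)"] M[of "y - x"] nR
      by (simp add: R_def n_def algebra_simps)
    have "B y - B x - - (B x o\<^sub>L A' (y - x) o\<^sub>L B x)
        = - (B y o\<^sub>L (A y - A x) o\<^sub>L B x) - - (B x o\<^sub>L A' (y - x) o\<^sub>L B x)"
      by (simp only: blinfun_inverse_diff[OF inv(2)[OF \<open>y \<in> S\<close>] inv(1)[OF \<open>x \<in> S\<close>]])
    also have "\<dots> = - ((B y - B x) o\<^sub>L (A y - A x) o\<^sub>L B x) - (B x o\<^sub>L R o\<^sub>L B x)"
      by (intro blinfun_eqI) (simp add: R_def blinfun.bilinear_simps)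
    also have "norm \<dots> \<le> norm (B y - B x) * norm (A y - A x) * norm (B x)
        + norm (B x) * norm R * norm (B x)"
      using norm_triangle_ineq4[of "- ((B y - B x) o\<^sub>L (A y - A x) o\<^sub>L B x)" "B x o\<^sub>L R o\<^sub>L B x"]
        norm_blinfun_compose3[of "B y - B x" "A y - A x" "B x"] norm_blinfun_compose3[of "B x" R "B x"] by simp
    also have "\<dots> \<le> norm (B y - B x) * ((r y + M) * n) * norm (B x)
        + norm (B x) * norm R * norm (B x)"
      by (intro add_mono mult_right_mono mult_left_mono D) auto
    also have "\<dots> = H y * n"
      by (simp add: nR H_def algebra_simps)
    finally show "norm (B y - B x - - (B x o\<^sub>L A' (y - x) o\<^sub>L B x)) / norm (y - x) \<le> H y"
      using \<open>n > 0\<close> by (simp add: n_def pos_divide_le_eq)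
  qed
qed

lemma C1_on_blinfun_inverse:
  fixes A :: "'a::real_normed_vector \<Rightarrow> 'b::real_normed_vector \<Rightarrow>\<^sub>L 'c::real_normed_vector"
  assumes A: "C1_on S A"
    and inv: "\<And>y. y \<in> S \<Longrightarrow> A y o\<^sub>L B y = id_blinfun" "\<And>y. y \<in> S \<Longrightarrow> B y o\<^sub>L A y = id_blinfun"
  shows "C1_on S B"
proof -
  obtain A' where A': "\<And>x. x \<in> S \<Longrightarrow> (A has_derivative blinfun_apply (A' x)) (at x within S)"
      and cA': "continuous_on S A'"
    using A unfolding C1_on_def by blast
  have B: "(B has_derivative (\<lambda>h. - (B x o\<^sub>L A' x h o\<^sub>L B x))) (at x within S)"
    if "x \<in> S" for x
    using A'[OF that] that inv by (rule has_derivative_blinfun_inverse)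
  have cB: "continuous_on S B"
    using B by (rule has_derivative_continuous_on)
  let ?L = "bounded_bilinear.prod_left (o\<^sub>L)" and ?R = "bounded_bilinear.prod_right (o\<^sub>L)"
  note lr = bounded_bilinear.prod_left.rep_eq[OF bounded_bilinear_blinfun_compose]
    bounded_bilinear.prod_right.rep_eq[OF bounded_bilinear_blinfun_compose]
  show ?thesis
  \<comment> \<open>\<open>?R (B x)\<close> composes with \<open>B x\<close> on the left and
    \<open>?L (B x)\<close> on the right, so this operator sends \<open>h\<close> to
    \<open>- (B x o A' x h o B x)\<close> while being visibly continuous in
    \<open>x\<close>.\<close>
  proof (rule C1_onI[where f' = "\<lambda>x. - (?L (B x) o\<^sub>L (?R (B x) o\<^sub>L A' x))"])
    show "(B has_derivative blinfun_apply (- (?L (B x) o\<^sub>L (?R (B x) o\<^sub>L A' x)))) (at x within S)"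
      if "x \<in> S" for x
      using B[OF that]
      by (rule has_derivative_eq_rhs) (auto simp: uminus_blinfun.rep_eq lr)
    show "continuous_on S (\<lambda>x. - (?L (B x) o\<^sub>L (?R (B x) o\<^sub>L A' x)))"
      using cA' cB
      by (intro continuous_intros
          bounded_linear.continuous_on[OF bounded_bilinear.bounded_linear_prod_left[OF bounded_bilinear_blinfun_compose]]
          bounded_linear.continuous_on[OF bounded_bilinear.bounded_linear_prod_right[OF bounded_bilinear_blinfun_compose]])
  qed
qed

section \<open>Extension of curves beyond a compact interval\<close>

text \<open>An antiderivative of \<open>q\<close> on the whole line has the same derivative as
  \<phi> on the interval, so the two differ there by a constant; adding that constant gives the
  extension.\<close>

lemma vector_derivative_extension:
  fixes \<phi> :: "real \<Rightarrow> 'a::euclidean_space"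
  assumes \<phi>: "\<And>x. x \<in> {a..b} \<Longrightarrow> (\<phi> has_vector_derivative q x) (at x within {a..b})"
    and q: "continuous_on UNIV q"
  obtains \<psi> where "\<And>x. (\<psi> has_vector_derivative q x) (at x)" and "\<And>x. x \<in> {a..b} \<Longrightarrow> \<psi> x = \<phi> x"
proof -
  obtain F where F: "\<And>x. (F has_vector_derivative q x) (at x)"
    using einterval_antiderivative[of "-\<infinity>" \<infinity> q] q
    by (auto simp: continuous_on_eq_continuous_at)
  have "((\<lambda>x. \<phi> x - F x) has_vector_derivative 0) (at x within {a..b})" if "x \<in> {a..b}" for x
    using has_vector_derivative_diff[OF \<phi>[OF that] has_vector_derivative_at_within[OF F]] by simp
  then obtain c where "\<And>x. x \<in> {a..b} \<Longrightarrow> \<phi> x - F x = c"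
    using has_derivative_zero_constant[of "{a..b}" "\<lambda>x. \<phi> x - F x"]
    by (auto simp: has_vector_derivative_def)
  then show thesis
    using F by (intro that[of "\<lambda>x. F x + c"]) (auto intro!: derivative_eq_intros simp: algebra_simps)
qed

text \<open>The second derivative is extended continuously to the line and then integrated twice,
  with constants of integration matched to the given derivative and function.\<close>

lemma C2_on_interval_extension:
  fixes \<phi> :: "real \<Rightarrow> 'a::euclidean_space"
  assumes "C2_on {a..b} \<phi>"
  obtains \<psi> where "C2_on UNIV \<psi>" and "\<And>x. x \<in> {a..b} \<Longrightarrow> \<psi> x = \<phi> x"
proof -
  obtain \<phi>' :: "real \<Rightarrow> real \<Rightarrow>\<^sub>L 'a" and \<phi>'' :: "real \<Rightarrow> real \<Rightarrow>\<^sub>L (real \<Rightarrow>\<^sub>L 'a)"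
    where d1: "\<And>x. x \<in> {a..b} \<Longrightarrow> (\<phi> has_derivative \<phi>' x) (at x within {a..b})"
      and d2: "\<And>x. x \<in> {a..b} \<Longrightarrow> (\<phi>' has_derivative \<phi>'' x) (at x within {a..b})"
      and c: "continuous_on {a..b} \<phi>''"
    using assms unfolding C2_on_def by blast
  have lin1: "blinfun_apply (\<phi>' x) h = h *\<^sub>R \<phi>' x 1" for x h
    by (metis blinfun.scaleR_right mult.right_neutral real_scaleR_def)
  have lin2: "blinfun_apply (\<phi>'' x) h = h *\<^sub>R \<phi>'' x 1" for x h
    by (metis blinfun.scaleR_right mult.right_neutral real_scaleR_def)
  \<comment> \<open>The ordinary second derivative, continued beyond each end point by its value
    there. Evaluation at 1 turns operators on the reals into vectors.\<close>
  define q where "q = ext_cont (\<lambda>x. blinfun_apply (blinfun_apply (\<phi>'' x) 1) 1) a b"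
  have q: "continuous_on UNIV q"
    unfolding q_def using c by (intro continuous_on_ext_cont) (auto intro!: continuous_intros)
  have q': "((\<lambda>x. blinfun_apply (\<phi>' x) 1) has_vector_derivative q x) (at x within {a..b})"
    if "x \<in> {a..b}" for x
    unfolding has_vector_derivative_def
  proof (rule has_derivative_eq_rhs)
    show "((\<lambda>x. blinfun_apply (\<phi>' x) 1) has_derivative (\<lambda>h. blinfun_apply (\<phi>'' x h) 1))
        (at x within {a..b})"
      using d2[OF that]
      by (rule bounded_linear.has_derivative[OF blinfun.bounded_linear_left])
    show "(\<lambda>h. blinfun_apply (\<phi>'' x h) 1) = (\<lambda>h. h *\<^sub>R q x)"
      using that by (subst lin2) (auto simp: q_def ext_cont_def blinfun.bilinear_simps)
  qed
  then obtain \<psi>\<^sub>1 where \<psi>1: "\<And>x. (\<psi>\<^sub>1 has_vector_derivative q x) (at x)"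
      and eq1: "\<And>x. x \<in> {a..b} \<Longrightarrow> \<psi>\<^sub>1 x = blinfun_apply (\<phi>' x) 1"
    using vector_derivative_extension[OF q' q] by blast
  have c1: "continuous_on UNIV \<psi>\<^sub>1"
    by (intro continuous_at_imp_continuous_on ballI has_vector_derivative_continuous[OF \<psi>1])
  have \<phi>: "(\<phi> has_vector_derivative \<psi>\<^sub>1 x) (at x within {a..b})" if "x \<in> {a..b}" for x
    using d1[OF that] eq1[OF that] unfolding has_vector_derivative_def
    by (subst (asm) lin1[abs_def]) simp
  then obtain \<psi> where \<psi>: "\<And>x. (\<psi> has_vector_derivative \<psi>\<^sub>1 x) (at x)"
      and eq: "\<And>x. x \<in> {a..b} \<Longrightarrow> \<psi> x = \<phi> x"
    using vector_derivative_extension[OF \<phi> c1] by blast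
  have "C2_on UNIV \<psi>"
  proof (rule C2_onI)
    show "(\<psi> has_derivative blinfun_apply (blinfun_scaleR_left (\<psi>\<^sub>1 x))) (at x)" for x
      using \<psi>[of x] by (simp add: has_vector_derivative_def)
    have "C1_on UNIV \<psi>\<^sub>1"
    proof (rule C1_onI)
      show "(\<psi>\<^sub>1 has_derivative blinfun_apply (blinfun_scaleR_left (q x))) (at x)" for x
        using \<psi>1[of x] by (simp add: has_vector_derivative_def)
    qed (intro bounded_linear.continuous_on[OF bounded_linear_blinfun_scaleR_left] q)
    then show "C1_on UNIV (\<lambda>x. blinfun_scaleR_left (\<psi>\<^sub>1 x))"
      using subset_UNIV
      by (rule C1_on_compose[OF C1_on_bounded_linear[OF bounded_linear_blinfun_scaleR_left]])
  qed
  then show thesis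
    using eq by (rule that)
qed

section \<open>Inverse functions near a compact set\<close>

text \<open>The inverse function theorem gives injectivity only near each point of \<open>K\<close>.
  Two nearby points lie in a common such neighbourhood, two distant ones have distinct images by
  injectivity on \<open>K\<close>, and compactness of \<open>K \<times> K\<close> makes this
  alternative uniform near \<open>K\<close>. The inverse on that neighbourhood agrees locally with
  the local inverses.\<close>

lemma C2_inverse_near_compact:
  fixes F :: "'a::euclidean_space \<Rightarrow> 'a" and F' :: "'a \<Rightarrow> 'a \<Rightarrow>\<^sub>L 'a"
  assumes "open U" and F: "\<And>x. x \<in> U \<Longrightarrow> (F has_derivative blinfun_apply (F' x)) (at x)"
    and C1: "C1_on U F'"
    and "compact K" "K \<subseteq> U" "inj_on F K"
    and injF': "\<And>x. x \<in> K \<Longrightarrow> inj (blinfun_apply (F' x))"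
  obtains W where "open W" "K \<subseteq> W" "W \<subseteq> U" "inj_on F W" "open (F ` W)"
    "C2_on (F ` W) (inv_into W F)"
proof -
  have cF: "continuous_on U F"
    using F \<open>open U\<close> by (meson continuous_at_imp_continuous_on has_derivative_continuous)
  have "\<forall>z\<in>K. \<exists>N V g. open N \<and> N \<subseteq> U \<and> z \<in> N \<and> open V \<and> homeomorphism N V F g \<and>
      (\<forall>y\<in>V. (g has_derivative inv (blinfun_apply (F' (g y)))) (at y) \<and> bij (blinfun_apply (F' (g y))))"
    (is "\<forall>z\<in>K. ?P z")
  proof
    fix z assume "z \<in> K"
    have "linear (blinfun_apply (F' z))"
      by (simp add: blinfun.bounded_linear_right bounded_linear.linear)
    \<comment> \<open>The left inverse is the invertibility witness that the inverse function
      theorem asks for.\<close>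
    then obtain L where L: "linear L" "L \<circ> blinfun_apply (F' z) = id"
      using linear_injective_left_inverse injF'[OF \<open>z \<in> K\<close>] by blast
    have "Blinfun L o\<^sub>L F' z = id_blinfun"
    proof (rule blinfun_eqI)
      show "blinfun_apply (Blinfun L o\<^sub>L F' z) v = blinfun_apply id_blinfun v" for v
        using L(2) by (simp add: bounded_linear_Blinfun_apply linear_conv_bounded_linear[THEN iffD1, OF L(1)]
            fun_eq_iff)
    qed
    moreover have "z \<in> U" using \<open>z \<in> K\<close> \<open>K \<subseteq> U\<close> by blast
    ultimately show "?P z"
      using inverse_function_theorem[OF \<open>open U\<close> F C1_on_imp_continuous_on[OF C1], of z "Blinfun L"]
      by metis
  qed
  then obtain N V g where *: "\<forall>z\<in>K. open (N z) \<and> N z \<subseteq> U \<and> z \<in> N z \<and> open (V z) \<and>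
      homeomorphism (N z) (V z) F (g z) \<and>
      (\<forall>y\<in>V z. (g z has_derivative inv (blinfun_apply (F' (g z y)))) (at y) \<and>
        bij (blinfun_apply (F' (g z y))))"
    unfolding bchoice_iff by blast
  have N: "\<And>z. z \<in> K \<Longrightarrow> open (N z)" "\<And>z. z \<in> K \<Longrightarrow> N z \<subseteq> U"
      "\<And>z. z \<in> K \<Longrightarrow> z \<in> N z"
    and V: "\<And>z. z \<in> K \<Longrightarrow> open (V z)" "\<And>z. z \<in> K \<Longrightarrow> homeomorphism (N z) (V z) F (g z)"
    and g: "\<And>z y. z \<in> K \<Longrightarrow> y \<in> V z \<Longrightarrow>
      (g z has_derivative inv (blinfun_apply (F' (g z y)))) (at y)"
    and bijF': "\<And>z y. z \<in> K \<Longrightarrow> y \<in> V z \<Longrightarrow> bij (blinfun_apply (F' (g z y)))"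
    using * by blast+
  \<comment> \<open>Pairs on which \<open>F\<close> cannot identify distinct points: either the
    images differ, or both points lie in one neighbourhood where \<open>F\<close> is
    injective.\<close>
  define Q where "Q = {p \<in> U \<times> U. F (fst p) - F (snd p) \<in> - {0}} \<union> (\<Union>z\<in>K. N z \<times> N z)"
  have "open Q"
    unfolding Q_def
  proof (intro open_Un open_UN ballI open_Times N)
    have "continuous_on (U \<times> U) (\<lambda>p. F (fst p) - F (snd p))"
      by (intro continuous_intros continuous_on_compose2[OF cF]) auto
    then have "open ((U \<times> U) \<inter> (\<lambda>p. F (fst p) - F (snd p)) -` (- {0}))"
      by (intro continuous_open_preimage open_Times \<open>open U\<close>) auto
    then show "open {p \<in> U \<times> U. F (fst p) - F (snd p) \<in> - {0}}"
      by (simp add: vimage_def Int_def)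
  qed
  moreover have "K \<times> K \<subseteq> Q"
  proof safe
    fix u v assume uv: "u \<in> K" "v \<in> K"
    show "(u, v) \<in> Q"
    proof (cases "u = v")
      case True
      then show ?thesis using uv N(3) by (auto simp: Q_def)
    next
      case False
      then have "F u \<noteq> F v" using uv \<open>inj_on F K\<close> by (simp add: inj_on_eq_iff)
      then show ?thesis using uv \<open>K \<subseteq> U\<close> by (auto simp: Q_def)
    qed
  qed
  ultimately obtain \<epsilon> where "\<epsilon> > 0" and \<epsilon>: "(\<Union>p\<in>K \<times> K. ball p \<epsilon>) \<subseteq> Q"
    using compact_subset_open_imp_ball_epsilon_subset[OF compact_Times[OF \<open>compact K\<close> \<open>compact K\<close>]]
    by blast
  \<comment> \<open>The radius is halved because distances in the product are at most the sum of the
    distances of the components. The second factor places each point of \<open>W\<close> in the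
    domain of a local inverse.\<close>
  define W where "W = (\<Union>z\<in>K. ball z (\<epsilon> / 2)) \<inter> (\<Union>z\<in>K. N z)"
  have "open W" unfolding W_def using N by auto
  have "K \<subseteq> W" unfolding W_def using N \<open>\<epsilon> > 0\<close> by force
  have "W \<subseteq> U" unfolding W_def using N by blast
  have injN: "inj_on F (N z)" if "z \<in> K" for z
    using homeomorphism_apply1[OF V(2)[OF that]] by (rule inj_on_inverseI)
  have "inj_on F W"
  proof (rule inj_onI)
    fix x y assume xy: "x \<in> W" "y \<in> W" "F x = F y"
    obtain u v where uv: "u \<in> K" "v \<in> K" "dist u x < \<epsilon> / 2" "dist v y < \<epsilon> / 2"
      using xy unfolding W_def by auto
    have "dist (u, v) (x, y) \<le> dist u x + dist v y"
      by (simp add: dist_Pair_Pair sqrt_sum_squares_le_sum)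
    then have "(x, y) \<in> ball (u, v) \<epsilon>" using uv by simp
    then have "(x, y) \<in> Q" using \<epsilon> uv by blast
    then obtain z where "z \<in> K" "x \<in> N z" "y \<in> N z"
      using xy(3) unfolding Q_def by auto
    then show "x = y" using injN xy(3) by (meson inj_onD)
  qed
  let ?G = "inv_into W F"
  have loc: "\<exists>O'. open O' \<and> y \<in> O' \<and> O' \<subseteq> F ` W \<and>
      (?G has_derivative inv (blinfun_apply (F' (?G y)))) (at y) \<and> bij (blinfun_apply (F' (?G y)))"
    if y: "y \<in> F ` W" for y
  proof -
    obtain x z where x: "x \<in> W" "y = F x" and z: "z \<in> K" "x \<in> N z"
      using y unfolding W_def by blast
    note hom = V(2)[OF z(1)]
    \<comment> \<open>On this open set the local inverse takes values in \<open>W\<close>, where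
      \<open>F\<close> is injective, so it coincides with \<open>?G\<close> and passes its
      derivative on.\<close>
    define O' where "O' = V z \<inter> g z -` W"
    have "open O'"
      unfolding O'_def using V(1)[OF z(1)] \<open>open W\<close> homeomorphism_cont2[OF hom]
      by (intro continuous_open_preimage)
    have gF: "g z (F x) = x" using hom z(2) by (rule homeomorphism_apply1)
    have "y \<in> V z" using hom z(2) x(2) by (metis homeomorphism_image1 imageI)
    then have "y \<in> O'" using gF x by (simp add: O'_def)
    have eq: "g z w = ?G w" "w \<in> F ` W" if "w \<in> O'" for w
    proof -
      have w: "F (g z w) = w" "g z w \<in> W"
        using that homeomorphism_apply2[OF hom] by (auto simp: O'_def)
      show "w \<in> F ` W" using imageI[OF w(2), of F] w(1) by simp
      show "g z w = ?G w" using inv_into_f_f[OF \<open>inj_on F W\<close> w(2)] w(1) by simp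
    qed
    have "(?G has_derivative inv (blinfun_apply (F' (g z y)))) (at y)"
      using g[OF z(1) \<open>y \<in> V z\<close>] \<open>open O'\<close> \<open>y \<in> O'\<close> eq(1)
      by (rule has_derivative_transform_within_open)
    then show ?thesis
      using \<open>open O'\<close> \<open>y \<in> O'\<close> eq(2) bijF'[OF z(1) \<open>y \<in> V z\<close>]
      unfolding eq(1)[OF \<open>y \<in> O'\<close>] by blast
  qed
  have "open (F ` W)"
    using loc open_subopen by meson
  \<comment> \<open>The derivative of \<open>?G\<close> as an operator. \<open>Blinfun\<close> is
    meaningful on the image of \<open>W\<close> because the inverse there occurs as a derivative and
    is thus bounded linear.\<close>
  define B where "B y = Blinfun (inv (blinfun_apply (F' (?G y))))" for y
  have B: "blinfun_apply (B y) = inv (blinfun_apply (F' (?G y)))" if "y \<in> F ` W" for y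
    using loc[OF that] unfolding B_def
    by (auto intro!: bounded_linear_Blinfun_apply dest: has_derivative_bounded_linear)
  have dG: "(?G has_derivative blinfun_apply (B y)) (at y within F ` W)" if "y \<in> F ` W" for y
    using loc[OF that] B[OF that] by (auto intro: has_derivative_at_withinI)
  have AB: "F' (?G y) o\<^sub>L B y = id_blinfun" "B y o\<^sub>L F' (?G y) = id_blinfun" if "y \<in> F ` W" for y
    using loc[OF that] B[OF that]
    by (auto intro!: blinfun_eqI simp: bij_is_surj surj_f_inv_f bij_is_inj)
  have GW: "?G ` F ` W \<subseteq> U"
    using \<open>W \<subseteq> U\<close> \<open>inj_on F W\<close> by auto
  \<comment> \<open>Bootstrapping: \<open>B\<close> is the pointwise inverse of \<open>F' \<circ> G\<close>, hence as regular as \<open>G\<close>.\<close>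
  have cG: "continuous_on (F ` W) ?G"
    using dG by (rule has_derivative_continuous_on)
  have "continuous_on (F ` W) (\<lambda>y. F' (?G y))"
    using C1_on_imp_continuous_on[OF C1] cG GW by (rule continuous_on_compose2)
  then have "continuous_on (F ` W) B"
    unfolding continuous_on_eq_continuous_within
    using continuous_within_blinfun_inverse[where S = "F ` W" and B = B, OF _ _ AB] by blast
  with dG have "C1_on (F ` W) ?G"
    by (rule C1_onI)
  with C1 have "C1_on (F ` W) (\<lambda>y. F' (?G y))"
    using GW by (rule C1_on_compose)
  then have "C1_on (F ` W) B"
    using AB by (rule C1_on_blinfun_inverse)
  with dG have "C2_on (F ` W) ?G"
    by (rule C2_onI)
  then show thesis
    using that \<open>open W\<close> \<open>K \<subseteq> W\<close> \<open>W \<subseteq> U\<close> \<open>inj_on F W\<close> \<open>open (F ` W)\<close> by blast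
qed

text \<open>\<open>F\<close> is a smooth extension of \<phi>. It witnesses that \<phi> is
  extendable, and its inverse on a neighbourhood of \<open>K\<close> witnesses the same for the
  inverse of \<phi>.\<close>

lemma C2_diffeomorphism_compactI:
  fixes \<phi> F :: "'a::euclidean_space \<Rightarrow> 'a"
  assumes "compact K" and bij: "bij_betw \<phi> K T"
    and "open U" "K \<subseteq> U" and F: "\<And>x. x \<in> U \<Longrightarrow> (F has_derivative blinfun_apply (F' x)) (at x)"
    and C1: "C1_on U F'" and eq: "\<And>x. x \<in> K \<Longrightarrow> F x = \<phi> x"
    and inj: "\<And>x. x \<in> K \<Longrightarrow> inj (blinfun_apply (F' x))"
  shows "C2_diffeomorphism K T \<phi>"
proof -
  have C2: "C2_on U F"
    using F C1 by (auto intro: C2_onI has_derivative_at_withinI)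
  have injK: "inj_on \<phi> K" and T: "T = \<phi> ` K"
    using bij by (auto simp: bij_betw_def)
  have "inj_on F K"
    using injK eq by (simp add: inj_on_def)
  then obtain W where W: "open W" "K \<subseteq> W" "W \<subseteq> U" "inj_on F W" "open (F ` W)"
    "C2_on (F ` W) (inv_into W F)"
    using C2_inverse_near_compact[OF \<open>open U\<close> F C1 \<open>compact K\<close> \<open>K \<subseteq> U\<close> _ inj] by blast
  have TW: "T \<subseteq> F ` W"
    using T eq \<open>K \<subseteq> W\<close> by force
  \<comment> \<open>Both inverses return the preimage in \<open>K\<close>: it lies in
    \<open>W\<close> as well, and \<open>F\<close> has no second preimage there.\<close>
  have inv: "inv_into W F y = inv_into K \<phi> y" if y: "y \<in> T" for y
  proof -
    obtain x where x: "x \<in> K" "y = \<phi> x" using y T by blast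
    then have "y = F x" "x \<in> W" using eq \<open>K \<subseteq> W\<close> by auto
    then show ?thesis
      using x inv_into_f_f[OF injK] inv_into_f_f[OF \<open>inj_on F W\<close>] by metis
  qed
  have "C2_extendable_on K \<phi>"
    using \<open>open U\<close> \<open>K \<subseteq> U\<close> C2 eq unfolding C2_extendable_on_def by blast
  moreover have "C2_extendable_on T (inv_into K \<phi>)"
    using W(5,6) TW inv unfolding C2_extendable_on_def by blast
  ultimately show ?thesis
    using bij by (simp add: C2_diffeomorphism_def)
qed

section \<open>The cell map\<close>

text \<open>Rewrites the components of the cell map as a linear combination, the form to which the
  rules for sums and scalar multiples apply.\<close>

lemma vector_2_eq_axis: "vector [u, v] = u *\<^sub>R axis 1 1 + v *\<^sub>R (axis 2 1 :: real^2)"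
  by (simp add: vec_eq_iff forall_2 axis_def)

lemma C2_on_cell_map:
  assumes "\<And>i. i \<in> {1,2,3,4} \<Longrightarrow> C2_on UNIV (h i) \<and> C2_on UNIV (g i)"
  shows "C2_on UNIV (cell_map h g a b)"
proof -
  have hg: "C2_on UNIV (\<lambda>x::real^2. h i (x $ k))" "C2_on UNIV (\<lambda>x::real^2. g i (x $ k))"
    if "i \<in> {1,2,3,4}" for i k
    using assms[OF that]
    by (auto intro!: C2_on_compose[where T = UNIV, OF _ C2_on_bounded_linear[OF bounded_linear_vec_nth]])
  have id: "C2_on UNIV (\<lambda>x::real^2. x $ k)" for k
    by (rule C2_on_bounded_linear[OF bounded_linear_vec_nth])
  show ?thesis
    unfolding cell_map_def[abs_def] Let_def vector_2_eq_axis
    by (intro C2_on_add C2_on_scaleR C2_on_mult C2_on_diff C2_on_divide_const C2_on_const id hg)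
      auto
qed

lemma mem_cbox_0_1_vec2: "x \<in> cbox 0 (1::real^2) \<longleftrightarrow> x $ 1 \<in> {0..1} \<and> x $ 2 \<in> {0..1}"
  by (auto simp: mem_box_cart forall_2)

theorem lemma35:
  fixes h g :: "nat \<Rightarrow> real \<Rightarrow> real" and a b :: real and f :: "(real^2) set"
  assumes "four_edge_cell f (edge h g)"
    and "\<forall>i\<in>{1,2,3,4}. C2_on {0..1} (h i) \<and> C2_on {0..1} (g i)"
    and "(h 1 0, g 1 0) = (0, 0)" and "(h 1 1, g 1 1) = (1, 0)"
    and "(h 2 0, g 2 0) = (1, 0)" and "(h 2 1, g 2 1) = (a, b)"
    and "(h 3 0, g 3 0) = (0, 1)" and "(h 3 1, g 3 1) = (a, b)"
    and "(h 4 0, g 4 0) = (0, 0)" and "(h 4 1, g 4 1) = (0, 1)"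
    and "a \<noteq> 0" and "b \<noteq> 0"
    and "bij_betw (cell_map h g a b) (cbox 0 1) (closure f)"
    and "\<forall>x\<in>cbox 0 1. det (jacobian (cell_map h g a b) (at x within cbox 0 1)) \<noteq> 0"
  shows "affine_compatible_coordinates (cbox 0 1) f (edge h g ` {1,2,3,4}) (cell_map h g a b)"
proof -
  let ?K = "cbox 0 1 :: (real^2) set" and ?\<phi> = "cell_map h g a b"
  have "\<exists>\<psi>. C2_on UNIV \<psi> \<and> (\<forall>x\<in>{0..1}. \<psi> x = \<phi> x)" if "C2_on {0..1} \<phi>" for \<phi> :: "real \<Rightarrow> real"
    using C2_on_interval_extension[OF that] by metis
  then have "\<forall>i\<in>{1,2,3,4}. \<exists>\<psi> \<eta>. C2_on UNIV \<psi> \<and> (\<forall>x\<in>{0..1}. \<psi> x = h i x) \<and>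
      C2_on UNIV \<eta> \<and> (\<forall>x\<in>{0..1}. \<eta> x = g i x)"
    using assms(2) by metis
  then obtain H G where HG: "\<And>i. i \<in> {1,2,3,4} \<Longrightarrow> C2_on UNIV (H i) \<and> C2_on UNIV (G i)"
    and eqHG: "\<And>i x. i \<in> {1,2,3,4} \<Longrightarrow> x \<in> {0..1} \<Longrightarrow> H i x = h i x \<and> G i x = g i x"
    by metis
  \<comment> \<open>The same formula with the extended curves; it agrees with \<open>?\<phi>\<close>
    on the square because every curve is evaluated there at a coordinate in
    \<open>[0,1]\<close>.\<close>
  define F where "F = cell_map H G a b"
  have eq: "F x = ?\<phi> x" if "x \<in> ?K" for x
    using that eqHG unfolding F_def cell_map_def Let_def mem_cbox_0_1_vec2 by simp
  have "C2_on UNIV F"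
    unfolding F_def using HG by (rule C2_on_cell_map)
  then obtain F' where F': "\<And>x. (F has_derivative blinfun_apply (F' x)) (at x)" and C1: "C1_on UNIV F'"
    by (rule C2_onE) auto
  have injF': "inj (blinfun_apply (F' x))" if x: "x \<in> ?K" for x
  proof -
    have d: "(?\<phi> has_derivative blinfun_apply (F' x)) (at x within ?K)"
      using has_derivative_at_withinI[OF F'[of x], of ?K] eq x
      by (metis (no_types, lifting) has_derivative_transform)
    \<comment> \<open>The Jacobian in the hypothesis is taken within the square. As the square is
      nondegenerate, derivatives within it are unique even at corners, so this Jacobian is the
      matrix of \<open>F' x\<close>.\<close>
    have "frechet_derivative ?\<phi> (at x within ?K) = blinfun_apply (F' x)"
    proof (rule frechet_derivative_unique_within_closed_interval[OF _ x])
      show "(?\<phi> has_derivative frechet_derivative ?\<phi> (at x within ?K)) (at x within ?K)"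
        using d frechet_derivative_works differentiable_def by blast
    qed (use d in \<open>auto simp: box_ne_empty Basis_vec_def inner_axis\<close>)
    then have "det (matrix (blinfun_apply (F' x))) \<noteq> 0"
      using assms(14) x by (auto simp: jacobian_def)
    then show ?thesis
      by (simp add: det_nz_iff_inj blinfun.bounded_linear_right bounded_linear.linear)
  qed
  have "C2_diffeomorphism ?K (closure f) ?\<phi>"
    using C2_diffeomorphism_compactI[OF compact_cbox assms(13) open_UNIV subset_UNIV F' C1 eq injF'] .
  moreover have "affine_curve (inv_into ?K ?\<phi> \<circ> edge h g i)"
    if i: "i \<in> {1,2,3,4}" for i
  proof -
    \<comment> \<open>If an edge is the image of a segment of the square run through at constant
      speed, injectivity makes the inverse map return exactly that segment.\<close>
    have side: "affine_curve (inv_into ?K ?\<phi> \<circ> edge h g i)"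
      if "\<And>t. t \<in> {0..1} \<Longrightarrow> c + t *\<^sub>R v \<in> ?K \<and> edge h g i t = ?\<phi> (c + t *\<^sub>R v)" for c v :: "real^2"
      using that assms(13) unfolding affine_curve_def bij_betw_def
      by (metis comp_apply inv_into_f_f)
    note corners = assms(3-12)
    consider "i = 1" | "i = 2" | "i = 3" | "i = 4" using i by auto
    then show ?thesis
    proof cases
      case 1
      \<comment> \<open>Each pair below is the starting corner and direction of a side. For
        \<open>p = 0\<close> the corner values \<open>h 2 0 = 1\<close>, \<open>h 4 0 = 0\<close>
        leave \<open>h 1 t\<close>, and the vertical weight vanishes, leaving
        \<open>g 1 t\<close>.\<close>
      show ?thesis
        by (rule side[of "vector [0, 0]" "vector [1, 0]"])
          (use corners 1 in \<open>auto simp: mem_cbox_0_1_vec2 edge_def cell_map_def\<close>)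
    next
      case 2
      \<comment> \<open>For \<open>t = 1\<close> the horizontal weight is
        \<open>p + (1 - p) = 1\<close> since \<open>h 3 1 / a = 1\<close>, leaving
        \<open>h 2 p\<close>; the vertical weight \<open>g 2 p / b\<close> multiplies
        \<open>g 3 1 = b\<close>. Edge 3 is symmetric.\<close>
      show ?thesis
        by (rule side[of "vector [1, 0]" "vector [0, 1]"])
          (use corners 2 in \<open>auto simp: mem_cbox_0_1_vec2 edge_def cell_map_def\<close>)
    next
      case 3
      show ?thesis
        by (rule side[of "vector [0, 1]" "vector [1, 0]"])
          (use corners 3 in \<open>auto simp: mem_cbox_0_1_vec2 edge_def cell_map_def\<close>)
    next
      case 4
      \<comment> \<open>For \<open>t = 0\<close> the horizontal weight vanishes, leaving
        \<open>h 4 p\<close>, and the vertical weight \<open>g 4 p\<close> multiplies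
        \<open>g 3 0 = 1\<close>.\<close>
      show ?thesis
        by (rule side[of "vector [0, 0]" "vector [0, 1]"])
          (use corners 4 in \<open>auto simp: mem_cbox_0_1_vec2 edge_def cell_map_def\<close>)
    qed
  qed
  ultimately show ?thesis
    by (auto simp: affine_compatible_coordinates_def)
qed

end
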